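(* Let $W$ be an $\aleph_0$-homogeneous closure space in which $\emptyset$ is closed. Then $W$ has exchange over $\emptyset$ if at least one of the following holds: (1) $\|W\| < \aleph_0$; (2) $\|W\| \ge \mathrm{LS}(W)^{++}$; (3) $W$ is $\mathrm{LS}(W)^+$-homogeneous and $\kappa(W) = \aleph_0$.
   Context: A closure space is a pair $W = (X, \mathrm{cl})$ where $X$ is a set (written $|W|$, with $\|W\| := |X|$) and $\mathrm{cl} : \mathcal{P}(X) \to \mathcal{P}(X)$ satisfies: $A \subseteq \mathrm{cl}(A)$, and $A \subseteq \mathrm{cl}(B)$ implies $\mathrm{cl}(A) \subseteq \mathrm{cl}(B)$. A set $A$ is closed if $\mathrm{cl}(A) = A$. An automorphism of $W$ is a bijection $f$ of $|W|$ with $f[\mathrm{cl}(A)] = \mathrm{cl}(f[A])$ for all $A$. For an infinite cardinal $\mu$, $W$ is $\mu$-homogeneous if for every $A \subseteq |W|$ with $|A| < \mu$ and all $a, b \in |W| \setminus \mathrm{cl}(A)$ there is an automorphism of $W$ fixing $A$ pointwise and sending $a$ to $b$. $\mathrm{LS}(W)$ is the least infinite cardinal $\mu$ such that $|\mathrm{cl}(A)| \le |A| + \mu$ for all $A \subseteq |W|$. $\kappa(W)$ is the least infinite cardinal $\kappa$ such that whenever $a \in \mathrm{cl}(A)$ there is $A_0 \subseteq A$ with $|A_0| < \kappa$ and $a \in \mathrm{cl}(A_0)$. $W$ has exchange over $\emptyset$ if for all $a, b$, $a \in \mathrm{cl}(\{b\}) \setminus \mathrm{cl}(\emptyset)$ implies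 $b \in \mathrm{cl}(\{a\})$. *)

theory Defs
  imports Main
begin

unbundle cardinal_syntax

text \<open>
  Cardinals are represented, as in the library, by well-orders \<open>r\<close> with \<open>Card_order r\<close>, compared by
  \<open>\<le>o\<close>, \<open><o\<close>, \<open>=o\<close>; \<open>Cinfinite\<close> says that a cardinal is infinite and \<open>natLeq\<close> is \<open>\<aleph>\<^sub>0\<close>.
\<close>

text \<open>The values of \<open>cl\<close> on sets that are not contained in \<open>X\<close> are irrelevant.\<close>

definition closure_space :: "'a set \<Rightarrow> ('a set \<Rightarrow> 'a set) \<Rightarrow> bool" where
  "closure_space X cl \<longleftrightarrow>
     (\<forall>A. A \<subseteq> X \<longrightarrow> cl A \<subseteq> X) \<and>
     (\<forall>A. A \<subseteq> X \<longrightarrow> A \<subseteq> cl A) \<and>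
     (\<forall>A B. A \<subseteq> X \<longrightarrow> B \<subseteq> X \<longrightarrow> A \<subseteq> cl B \<longrightarrow> cl A \<subseteq> cl B)"

definition cs_closed :: "'a set \<Rightarrow> ('a set \<Rightarrow> 'a set) \<Rightarrow> 'a set \<Rightarrow> bool" where
  "cs_closed X cl A \<longleftrightarrow> A \<subseteq> X \<and> cl A = A"

definition cs_automorphism :: "'a set \<Rightarrow> ('a set \<Rightarrow> 'a set) \<Rightarrow> ('a \<Rightarrow> 'a) \<Rightarrow> bool" where
  "cs_automorphism X cl f \<longleftrightarrow>
     bij_betw f X X \<and> (\<forall>A. A \<subseteq> X \<longrightarrow> f ` cl A = cl (f ` A))"

definition cs_homogeneous :: "'b rel \<Rightarrow> 'a set \<Rightarrow> ('a set \<Rightarrow> 'a set) \<Rightarrow> bool" where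
  "cs_homogeneous \<mu> X cl \<longleftrightarrow>
     (\<forall>A. A \<subseteq> X \<longrightarrow> |A| <o \<mu> \<longrightarrow>
       (\<forall>a \<in> X - cl A. \<forall>b \<in> X - cl A.
          \<exists>f. cs_automorphism X cl f \<and> (\<forall>x\<in>A. f x = x) \<and> f a = b))"

definition cs_exchange_empty :: "'a set \<Rightarrow> ('a set \<Rightarrow> 'a set) \<Rightarrow> bool" where
  "cs_exchange_empty X cl \<longleftrightarrow>
     (\<forall>a\<in>X. \<forall>b\<in>X. a \<in> cl {b} - cl {} \<longrightarrow> b \<in> cl {a})"

text \<open>
  The least infinite cardinal with property \<open>P\<close>, among the cardinals on the type \<open>'b\<close>; it is
  determined up to \<open>=o\<close>. When the type \<open>'b\<close> is large enough for \<open>P\<close> to hold of some cardinal on it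
  and \<open>P\<close> respects \<open>=o\<close>, this is the least such cardinal on any type.
\<close>

definition least_Cinfinite :: "('b rel \<Rightarrow> bool) \<Rightarrow> 'b rel" where
  "least_Cinfinite P =
     (SOME r. Cinfinite r \<and> P r \<and> (\<forall>r'. Cinfinite r' \<and> P r' \<longrightarrow> r \<le>o r'))"

definition LS_bound :: "'a set \<Rightarrow> ('a set \<Rightarrow> 'a set) \<Rightarrow> 'b rel \<Rightarrow> bool" where
  "LS_bound X cl \<mu> \<longleftrightarrow> (\<forall>A. A \<subseteq> X \<longrightarrow> |cl A| \<le>o |A| +c \<mu>)"

definition kappa_bound :: "'a set \<Rightarrow> ('a set \<Rightarrow> 'a set) \<Rightarrow> 'b rel \<Rightarrow> bool" where
  "kappa_bound X cl \<kappa> \<longleftrightarrow>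
     (\<forall>A a. A \<subseteq> X \<longrightarrow> a \<in> cl A \<longrightarrow> (\<exists>A\<^sub>0. A\<^sub>0 \<subseteq> A \<and> |A\<^sub>0| <o \<kappa> \<and> a \<in> cl A\<^sub>0))"

text \<open>
  \<open>LS(W)\<close> is at most \<open>|X| + \<aleph>\<^sub>0\<close> and \<open>\<kappa>(W)\<close> is at most \<open>(|X| + \<aleph>\<^sub>0)\<^sup>+\<close>, so both are attained on
  the type \<open>('a + nat) set\<close>; see \<open>cs_LS_least\<close> and \<open>cs_kappa_least\<close> below.
\<close>

definition cs_LS :: "'a set \<Rightarrow> ('a set \<Rightarrow> 'a set) \<Rightarrow> ('a + nat) set rel" where
  "cs_LS X cl = least_Cinfinite (LS_bound X cl)"

definition cs_kappa :: "'a set \<Rightarrow> ('a set \<Rightarrow> 'a set) \<Rightarrow> ('a + nat) set rel" where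
  "cs_kappa X cl = least_Cinfinite (kappa_bound X cl)"

lemma least_Cinfinite:
  fixes P :: "'b rel \<Rightarrow> bool"
  assumes "Cinfinite r" "P r"
  shows "Cinfinite (least_Cinfinite P)" "P (least_Cinfinite P)"
    "\<And>r'. Cinfinite r' \<Longrightarrow> P r' \<Longrightarrow> least_Cinfinite P \<le>o r'"
proof -
  let ?R = "{r. Cinfinite r \<and> P r}"
  have "\<exists>r\<in>?R. \<forall>r'\<in>?R. r \<le>o r'"
    by (rule exists_minim_Card_order) (use assms in auto)
  then have "\<exists>r. Cinfinite r \<and> P r \<and> (\<forall>r'. Cinfinite r' \<and> P r' \<longrightarrow> r \<le>o r')"
    by blast
  from someI_ex[OF this]
  have *: "Cinfinite (least_Cinfinite P) \<and> P (least_Cinfinite P) \<and>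
      (\<forall>r'. Cinfinite r' \<and> P r' \<longrightarrow> least_Cinfinite P \<le>o r')"
    unfolding least_Cinfinite_def .
  show "Cinfinite (least_Cinfinite P)" "P (least_Cinfinite P)"
    "\<And>r'. Cinfinite r' \<Longrightarrow> P r' \<Longrightarrow> least_Cinfinite P \<le>o r'"
    using * by blast+
qed

lemma least_Cinfinite_any_type:
  fixes P :: "'b rel \<Rightarrow> bool" and Q :: "'c rel \<Rightarrow> bool" and r' :: "'c rel"
  assumes ex: "Cinfinite r" "P r"
    and transfer: "\<And>s t. Q s \<Longrightarrow> s =o t \<Longrightarrow> P t"
    and r': "Cinfinite r'" "Q r'"
  shows "least_Cinfinite P \<le>o r'"
proof (rule ccontr)
  let ?L = "least_Cinfinite P"
  have L: "Card_order ?L" using least_Cinfinite(1)[of r P, OF ex] by blast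
  assume neg: "\<not> ?L \<le>o r'"
  have wo: "Well_order ?L" "Well_order r'"
    using L r' by (auto simp: card_order_on_def)
  have less: "r' <o ?L"
    using neg wo by (simp add: not_ordLeq_iff_ordLess)
  have "|Field r'| \<le>o |Field ?L|"
    by (rule card_of_mono2) (rule ordLess_imp_ordLeq[OF less])
  then obtain f where f: "inj_on f (Field r')" "f ` Field r' \<subseteq> Field ?L"
    by (auto simp: card_of_ordLeq[symmetric])
  let ?t = "|f ` Field r'|"
  have "|Field r'| =o ?t"
    using f(1) by (meson card_of_ordIsoI inj_on_imp_bij_betw)
  then have iso: "r' =o ?t"
    using card_of_Field_ordIso r' ordIso_symmetric ordIso_transitive by blast
  have "Cinfinite ?t"
    using Cinfinite_cong[OF iso r'(1)] .
  then have "?L \<le>o ?t"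
    using least_Cinfinite(3)[of r P, OF ex] transfer[OF r'(2) iso] by blast
  then have "?L \<le>o r'"
    using iso ordIso_symmetric ordLeq_ordIso_trans by blast
  then show False using neg by blast
qed

lemma LS_bound_cong: "LS_bound X cl s \<Longrightarrow> s =o t \<Longrightarrow> LS_bound X cl t"
  unfolding LS_bound_def by (meson csum_cong2 ordLeq_ordIso_trans)

lemma kappa_bound_cong: "kappa_bound X cl s \<Longrightarrow> s =o t \<Longrightarrow> kappa_bound X cl t"
  unfolding kappa_bound_def by (meson ordLess_ordIso_trans)

lemma Cinfinite_big: "Cinfinite |UNIV :: ('a + nat) set set|"
  by (simp add: cinfinite_def Field_card_of card_of_card_order_on Finite_Set.finite_set)

lemma ordLess_big: "|A :: 'a set| <o |UNIV :: ('a + nat) set set|"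
proof -
  have "|A| \<le>o |UNIV :: ('a + nat) set|"
    by (rule card_of_ordLeqI[of Inl]) (auto simp: inj_on_def)
  also have "|UNIV :: ('a + nat) set| <o |UNIV :: ('a + nat) set set|"
    using card_of_Pow[of "UNIV :: ('a + nat) set"] by (simp add: Pow_UNIV)
  finally show ?thesis .
qed

lemma LS_bound_big: "LS_bound X cl |UNIV :: ('a + nat) set set|" for X :: "'a set"
  unfolding LS_bound_def
  by (meson Card_order_csum card_of_Card_order ordLeq_csum2 ordLess_big ordLess_imp_ordLeq ordLeq_transitive)

lemma kappa_bound_big: "kappa_bound X cl |UNIV :: ('a + nat) set set|" for X :: "'a set"
  unfolding kappa_bound_def using ordLess_big by blast

lemma cs_LS:
  shows "Cinfinite (cs_LS X cl)" "LS_bound X cl (cs_LS X cl)"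
  unfolding cs_LS_def
  using least_Cinfinite(1,2)[of _ "LS_bound X cl", OF Cinfinite_big LS_bound_big] by blast+

lemma cs_LS_least:
  fixes \<mu> :: "'c rel"
  assumes "Cinfinite \<mu>" "LS_bound X cl \<mu>"
  shows "cs_LS X cl \<le>o \<mu>"
  unfolding cs_LS_def
  by (rule least_Cinfinite_any_type[where P = "LS_bound X cl" and Q = "LS_bound X cl", OF Cinfinite_big LS_bound_big])
    (use assms LS_bound_cong in blast)+

lemma cs_kappa:
  shows "Cinfinite (cs_kappa X cl)" "kappa_bound X cl (cs_kappa X cl)"
  unfolding cs_kappa_def
  using least_Cinfinite(1,2)[of _ "kappa_bound X cl", OF Cinfinite_big kappa_bound_big] by blast+

lemma cs_kappa_least:
  fixes \<kappa> :: "'c rel"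
  assumes "Cinfinite \<kappa>" "kappa_bound X cl \<kappa>"
  shows "cs_kappa X cl \<le>o \<kappa>"
  unfolding cs_kappa_def
  by (rule least_Cinfinite_any_type[where P = "kappa_bound X cl" and Q = "kappa_bound X cl", OF Cinfinite_big kappa_bound_big])
    (use assms kappa_bound_cong in blast)+

end

theory Submission
  imports Defs
begin

text \<open>
  Write \<open>a \<le> b\<close> for \<open>a \<in> cl {b}\<close>. Automorphisms act transitively on \<open>X\<close>, since \<open>{}\<close> is closed.
  If exchange over \<open>{}\<close> fails, then every \<open>x\<close> has some \<open>y > x\<close>, and by homogeneity over \<open>{x}\<close>
  every point outside \<open>cl {x}\<close> lies above \<open>x\<close>: the preorder is total without maximum, and
  its principal initial segments \<open>cl {x}\<close> have size at most \<open>\<lambda> = LS(W)\<close>.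
  (1) If \<open>X\<close> is finite, all \<open>cl {x}\<close> have the same size, so \<open>cl {a} \<subseteq> cl {b}\<close> forces equality.
  (2) If \<open>|X| \<ge> \<lambda>\<^sup>+\<^sup>+\<close>, a set of size \<open>\<lambda>\<^sup>+\<close> is not cofinal, hence it is contained in some \<open>cl {x}\<close>,
  which is too small.
  (3) If \<open>\<kappa>(W) = \<aleph>\<^sub>0\<close>, the set \<open>D\<close> of points strictly below \<open>a\<close> is closed. For \<open>b > a\<close>, an
  automorphism fixing \<open>D\<close> pointwise and sending \<open>a\<close> to \<open>b\<close> maps \<open>D\<close> onto the points strictly
  below \<open>b\<close>, one of which is \<open>a \<notin> D\<close>.
\<close>

lemma cl_singleton_mono:
  assumes "closure_space X cl" "b \<in> X" "a \<in> cl {b}"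
  shows "cl {a} \<subseteq> cl {b}"
proof -
  have "cl {b} \<subseteq> X"
    using assms(1,2) unfolding closure_space_def by simp
  then show ?thesis
    using assms unfolding closure_space_def by (meson empty_subsetI insert_subset subsetD)
qed

lemma cl_singleton_refl:
  assumes "closure_space X cl" "a \<in> X"
  shows "a \<in> cl {a}"
  using assms unfolding closure_space_def by (meson empty_subsetI insert_subset)

lemma cs_automorphism_mem_cl_iff:
  assumes cs: "closure_space X cl" and f: "cs_automorphism X cl f" and "a \<in> X" "b \<in> X"
  shows "f a \<in> cl {f b} \<longleftrightarrow> a \<in> cl {b}"
proof -
  have "cl {f b} = f ` cl {b}"
    using f \<open>b \<in> X\<close> unfolding cs_automorphism_def
    by (metis empty_subsetI image_empty image_insert insert_subset)
  moreover have "inj_on f X"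
    using f unfolding cs_automorphism_def bij_betw_def by blast
  moreover have "cl {b} \<subseteq> X"
    using cs \<open>b \<in> X\<close> unfolding closure_space_def by simp
  ultimately show ?thesis
    using \<open>a \<in> X\<close> by (simp add: inj_on_image_mem_iff)
qed

lemma cs_automorphism_mem:
  assumes "cs_automorphism X cl f" "a \<in> X"
  shows "f a \<in> X"
  using assms unfolding cs_automorphism_def by (auto dest: bij_betwE)

lemma cs_homogeneousE:
  assumes "cs_homogeneous \<mu> X cl" "A \<subseteq> X" "|A| <o \<mu>" "a \<in> X - cl A" "b \<in> X - cl A"
  obtains f where "cs_automorphism X cl f" "\<And>x. x \<in> A \<Longrightarrow> f x = x" "f a = b"
  using assms unfolding cs_homogeneous_def by meson

lemma cs_homogeneous_transitive:
  assumes "cs_homogeneous natLeq X cl" "cs_closed X cl {}" "a \<in> X" "b \<in> X"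
  obtains f where "cs_automorphism X cl f" "f a = b"
proof (rule cs_homogeneousE[OF assms(1), of "{}" a b])
  show "|{} :: 'a set| <o natLeq"
    using finite_iff_ordLess_natLeq by blast
qed (use assms that in \<open>auto simp: cs_closed_def\<close>)

text \<open>A failure of exchange is one pair \<open>a\<close>, \<open>b\<close> with
  \<open>b\<close> strictly above \<open>a\<close>. An automorphism taking \<open>a\<close> to
  \<open>x\<close> carries \<open>b\<close> to a point strictly above \<open>x\<close>.\<close>

lemma not_exchange_above:
  assumes cs: "closure_space X cl" and hom: "cs_homogeneous natLeq X cl"
    and emp: "cs_closed X cl {}" and "\<not> cs_exchange_empty X cl" and x: "x \<in> X"
  obtains y where "y \<in> X" "x \<in> cl {y}" "y \<notin> cl {x}"
proof -
  obtain a b where ab: "a \<in> X" "b \<in> X" "a \<in> cl {b}" "b \<notin> cl {a}"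
    using assms(4) unfolding cs_exchange_empty_def by blast
  obtain f where f: "cs_automorphism X cl f" "f a = x"
    using cs_homogeneous_transitive[OF hom emp ab(1) x] by blast
  show thesis
    using that[of "f b"] cs_automorphism_mem[OF f(1) ab(2)]
      cs_automorphism_mem_cl_iff[OF cs f(1)] ab f(2) by blast
qed

text \<open>Some \<open>y\<close> lies strictly above \<open>x\<close>. Since \<open>y\<close> and
  \<open>z\<close> both avoid \<open>cl {x}\<close>, an automorphism fixing \<open>x\<close> moves
  \<open>y\<close> to \<open>z\<close> and so transports \<open>x \<in> cl {y}\<close>.\<close>

lemma not_exchange_total:
  assumes cs: "closure_space X cl" and hom: "cs_homogeneous natLeq X cl"
    and emp: "cs_closed X cl {}" and nex: "\<not> cs_exchange_empty X cl"
    and x: "x \<in> X" and z: "z \<in> X" and "z \<notin> cl {x}"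
  shows "x \<in> cl {z}"
proof -
  obtain y where y: "y \<in> X" "x \<in> cl {y}" "y \<notin> cl {x}"
    using not_exchange_above[OF cs hom emp nex x] .
  have fin: "|{x}| <o natLeq"
    using finite_iff_ordLess_natLeq by blast
  obtain f where f: "cs_automorphism X cl f" "f x = x" "f y = z"
    using cs_homogeneousE[OF hom _ fin, of y z] x y z assms(7) by auto
  show ?thesis
    using cs_automorphism_mem_cl_iff[OF cs f(1) x y(1)] f y by simp
qed

lemma card_cl_singleton_le_LS: "a \<in> X \<Longrightarrow> |cl {a}| \<le>o cs_LS X cl"
proof -
  assume "a \<in> X"
  then have "|cl {a}| \<le>o |{a}| +c cs_LS X cl"
    using cs_LS(2)[of X cl] unfolding LS_bound_def by simp
  also have "|{a}| +c cs_LS X cl =o cs_LS X cl"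
  proof (rule csum_absorb2[OF cs_LS(1)], rule ordLess_imp_ordLeq, rule finite_ordLess_infinite)
    show "Well_order (cs_LS X cl)" "infinite (Field (cs_LS X cl))"
      using cs_LS(1)[of X cl] by (auto simp: cinfinite_def card_order_on_def)
  qed (simp_all add: Field_card_of card_of_well_order_on)
  finally show ?thesis .
qed

text \<open>In a total preorder a maximum survives adding one point. This reduces the closure of a
  finite set to that of a single point.\<close>

lemma finite_has_cl_maximum:
  assumes cs: "closure_space X cl"
    and total: "\<And>x z. x \<in> X \<Longrightarrow> z \<in> X \<Longrightarrow> z \<notin> cl {x} \<Longrightarrow> x \<in> cl {z}"
    and "finite F" "F \<noteq> {}" "F \<subseteq> X"
  shows "\<exists>m\<in>F. F \<subseteq> cl {m}"
  using assms(3-5)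
proof (induction F rule: finite_ne_induct)
  case (singleton x)
  then show ?case using cl_singleton_refl[OF cs] by simp
next
  case (insert x F)
  then obtain m where m: "m \<in> F" "F \<subseteq> cl {m}" by auto
  show ?case
  proof (cases "x \<in> cl {m}")
    case True
    then show ?thesis using m by auto
  next
    case False
    then have "m \<in> cl {x}"
      using total m insert.prems by blast
    then have "F \<subseteq> cl {x}"
      using cl_singleton_mono[OF cs, of x m] insert.prems m by blast
    then show ?thesis
      using cl_singleton_refl[OF cs, of x] insert.prems by blast
  qed
qed

lemma exchange_finite:
  assumes cs: "closure_space X cl" and hom: "cs_homogeneous natLeq X cl"
    and emp: "cs_closed X cl {}" and "finite X"
  shows "cs_exchange_empty X cl"
  unfolding cs_exchange_empty_def
proof (intro ballI impI)
  fix a b assume a: "a \<in> X" and b: "b \<in> X" and "a \<in> cl {b} - cl {}"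
  then have sub: "cl {a} \<subseteq> cl {b}"
    using cl_singleton_mono[OF cs b] by blast
  obtain f where f: "cs_automorphism X cl f" "f a = b"
    using cs_homogeneous_transitive[OF hom emp a b] .
  have X: "cl {a} \<subseteq> X" "cl {b} \<subseteq> X"
    using cs a b unfolding closure_space_def by auto
  \<comment> \<open>\<open>f\<close> restricts to a bijection from \<open>cl {a}\<close> onto
    \<open>cl {b}\<close>, whence the equal sizes.\<close>
  have "f ` cl {a} = cl (f ` {a})"
    using f(1) a unfolding cs_automorphism_def by blast
  then have "cl {b} = f ` cl {a}"
    using f(2) by simp
  moreover have "inj_on f (cl {a})"
    using f(1) X unfolding cs_automorphism_def bij_betw_def by (meson inj_on_subset)
  ultimately have "card (cl {b}) = card (cl {a})"
    by (simp add: card_image)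
  then have "cl {a} = cl {b}"
    using card_subset_eq[OF finite_subset[OF X(2) \<open>finite X\<close>] sub] by simp
  then show "b \<in> cl {a}"
    using cl_singleton_refl[OF cs b] by simp
qed

lemma exchange_large:
  fixes X :: "'a set"
  assumes cs: "closure_space X cl" and hom: "cs_homogeneous natLeq X cl"
    and emp: "cs_closed X cl {}" and large: "cardSuc (cardSuc (cs_LS X cl)) \<le>o |X|"
  shows "cs_exchange_empty X cl"
proof (rule ccontr)
  assume nex: "\<not> cs_exchange_empty X cl"
  let ?L = "cs_LS X cl"
  have L: "Card_order ?L" "Cinfinite (cardSuc ?L)"
    using cs_LS(1)[of X cl] by (auto simp: Cinfinite_cardSuc)
  have less: "cardSuc ?L <o |X|"
    using cardSuc_greater[OF cardSuc_Card_order[OF L(1)]] large ordLess_ordLeq_trans by blast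
  have "|Field (cardSuc ?L)| \<le>o |X|"
    using card_of_Field_ordIso[OF cardSuc_Card_order[OF L(1)]] less
    by (meson ordIso_ordLess_trans ordLess_imp_ordLeq)
  then obtain g where g: "inj_on g (Field (cardSuc ?L))" "g ` Field (cardSuc ?L) \<subseteq> X"
    by (auto simp: card_of_ordLeq[symmetric])
  \<comment> \<open>A subset of \<open>X\<close> of size exactly \<lambda>^+.\<close>
  define S where "S = g ` Field (cardSuc ?L)"
  have "|Field (cardSuc ?L)| =o |S|"
    unfolding S_def using g(1) by (meson card_of_ordIsoI inj_on_imp_bij_betw)
  then have S: "|S| =o cardSuc ?L"
    using card_of_Field_ordIso[OF cardSuc_Card_order[OF L(1)]]
    by (meson ordIso_symmetric ordIso_transitive)
  have SX: "S \<subseteq> X"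
    using g(2) by (simp add: S_def)
  \<comment> \<open>A union of \<lambda>^+ sets, each of size at most \<lambda>, cannot cover
    \<open>X\<close>; a point outside it lies above all of \<open>S\<close> by totality.\<close>
  have "|\<Union>s\<in>S. cl {s}| \<le>o cardSuc ?L"
  proof (rule card_of_UNION_ordLeq_infinite_Field)
    show "\<forall>s\<in>S. |cl {s}| \<le>o cardSuc ?L"
      using card_cl_singleton_le_LS[of _ X cl] cardSuc_ordLeq[OF L(1)] SX
      by (meson ordLeq_transitive subsetD)
  qed (use L S in \<open>auto simp: cinfinite_def ordIso_iff_ordLeq\<close>)
  then have "|\<Union>s\<in>S. cl {s}| <o |X|"
    using less ordLeq_ordLess_trans by blast
  then have "\<not> X \<subseteq> (\<Union>s\<in>S. cl {s})"
    using card_of_mono1 not_ordLess_ordLeq by blast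
  then obtain x where x: "x \<in> X" "\<And>s. s \<in> S \<Longrightarrow> x \<notin> cl {s}"
    by blast
  have "S \<subseteq> cl {x}"
    using not_exchange_total[OF cs hom emp nex] x SX by blast
  then have "|S| \<le>o ?L"
    using card_of_mono1 card_cl_singleton_le_LS[OF x(1)] ordLeq_transitive by blast
  then have "cardSuc ?L \<le>o ?L"
    using S by (meson ordIso_ordLeq_trans ordIso_symmetric)
  then show False
    using cardSuc_greater[OF L(1)] not_ordLess_ordLeq by blast
qed

lemma exchange_kappa_natLeq:
  assumes cs: "closure_space X cl" and hom: "cs_homogeneous natLeq X cl"
    and emp: "cs_closed X cl {}"
    and homL: "cs_homogeneous (cardSuc (cs_LS X cl)) X cl" and kap: "cs_kappa X cl =o natLeq"
  shows "cs_exchange_empty X cl"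
proof (rule ccontr)
  assume nex: "\<not> cs_exchange_empty X cl"
  note total = not_exchange_total[OF cs hom emp nex]
  obtain a where a: "a \<in> X"
    using nex unfolding cs_exchange_empty_def by blast
  obtain b where b: "b \<in> X" "a \<in> cl {b}" "b \<notin> cl {a}"
    using not_exchange_above[OF cs hom emp nex a] .
  define D where "D = {x \<in> cl {a}. a \<notin> cl {x}}"
  have DX: "D \<subseteq> X"
    using cs a unfolding closure_space_def D_def by auto
  have "D \<subseteq> cl {a}"
    by (auto simp: D_def)
  then have "|D| \<le>o cs_LS X cl"
    using card_of_mono1 card_cl_singleton_le_LS[OF a] ordLeq_transitive by blast
  then have D_small: "|D| <o cardSuc (cs_LS X cl)"
    using cardSuc_greater[of "cs_LS X cl"] cs_LS(1)[of X cl] ordLeq_ordLess_trans by blast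
  \<comment> \<open>Finite character puts \<open>x\<close> in \<open>cl F\<close> for a finite
    \<open>F \<subseteq> D\<close>, nonempty because \<open>cl {}\<close> is empty. The maximum
    \<open>m\<close> of \<open>F\<close> then satisfies
    \<open>cl F \<subseteq> cl {m}\<close>.\<close>
  have D_bounded: "\<exists>m\<in>D. x \<in> cl {m}" if x: "x \<in> cl D" for x
  proof -
    obtain F where F: "F \<subseteq> D" "|F| <o cs_kappa X cl" "x \<in> cl F"
      using cs_kappa(2)[of X cl] DX x unfolding kappa_bound_def by meson
    have "finite F"
      using F(2) kap ordLess_ordIso_trans finite_iff_ordLess_natLeq by blast
    moreover have "F \<noteq> {}"
      using F(3) emp by (auto simp: cs_closed_def)
    ultimately obtain m where m: "m \<in> F" "F \<subseteq> cl {m}"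
      using finite_has_cl_maximum[OF cs total, of F] F(1) DX by blast
    moreover have "cl F \<subseteq> cl {m}"
      using cs m F(1) DX unfolding closure_space_def
      by (meson empty_subsetI insert_subset subsetD subset_trans)
    ultimately show ?thesis
      using F by blast
  qed
  have "a \<notin> cl D"
    using D_bounded by (auto simp: D_def)
  moreover have "b \<notin> cl D"
  proof
    \<comment> \<open>Here \<open>b\<close> would lie below some \<open>m \<in> D\<close>, hence
      below \<open>a\<close>.\<close>
    assume "b \<in> cl D"
    then obtain m where "m \<in> D" "b \<in> cl {m}" using D_bounded by blast
    then show False
      using cl_singleton_mono[OF cs a] b(3) by (auto simp: D_def)
  qed
  ultimately obtain f where f: "cs_automorphism X cl f" "\<And>x. x \<in> D \<Longrightarrow> f x = x" "f a = b"
    using cs_homogeneousE[OF homL DX D_small, of a b] a b(1) by blast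
  have "f ` X = X"
    using f(1) unfolding cs_automorphism_def bij_betw_def by simp
  then obtain x where x: "x \<in> X" "f x = a"
    using a by (metis imageE)
  \<comment> \<open>\<open>f x = a\<close> is strictly below \<open>b = f a\<close>, and
    \<open>f\<close> reflects the order, so \<open>x\<close> is strictly below \<open>a\<close>.
    Being in \<open>D\<close>, \<open>x\<close> is fixed, which forces \<open>x = a\<close>.\<close>
  have "x \<in> D"
    using cs_automorphism_mem_cl_iff[OF cs f(1) x(1) a] cs_automorphism_mem_cl_iff[OF cs f(1) a x(1)]
      x(2) f(3) b by (simp add: D_def)
  then have "a \<in> D"
    using f(2)[of x] x(2) by simp
  then show False
    using cl_singleton_refl[OF cs a] by (simp add: D_def)
qed

theorem theorem2p10:
  fixes X :: "'a set" and cl :: "'a set \<Rightarrow> 'a set"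
  assumes "closure_space X cl"
    and "cs_homogeneous natLeq X cl"
    and "cs_closed X cl {}"
    and "|X| <o natLeq
       \<or> cardSuc (cardSuc (cs_LS X cl)) \<le>o |X|
       \<or> (cs_homogeneous (cardSuc (cs_LS X cl)) X cl \<and> cs_kappa X cl =o natLeq)"
  shows "cs_exchange_empty X cl"
  using assms(4)
proof (elim disjE conjE)
  assume "|X| <o natLeq"
  then show ?thesis
    using exchange_finite[OF assms(1-3)] by (simp add: finite_iff_ordLess_natLeq)
qed (fact exchange_large[OF assms(1-3)] exchange_kappa_natLeq[OF assms(1-3)])+

end
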